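(* Let $d \geq 2$ and let $\mathcal{C}$ be a pure $d$-dimensional $1$-decomposable simplicial complex with vertex set $[n]=\{1,\dots,n\}$. Let $H$ be a set of $d-2$ new elements disjoint from $[n]$, and let $\Delta_{n+d-3}^{(d)}$ denote the $d$-skeleton of the simplex on the $n+d-2$ vertices $[n]\cup H$, i.e. the complex whose facets are all $(d+1)$-element subsets of $[n]\cup H$. Then the facets of $\Delta_{n+d-3}^{(d)}$ that are not facets of $\mathcal{C}$ can be ordered as $F_1,\dots,F_t$ so that $\mathcal{C} + \langle F_1,\dots,F_i \rangle$ is $1$-decomposable for all $1 \leq i \leq t$.
   Context: A simplicial complex on a finite ground set $V$ is a collection of subsets of $V$ closed under taking subsets; its elements are faces, elements $v$ with $\{v\}$ a face are vertices, maximal faces are facets, and the dimension of a face $F$ is $|F|-1$. A complex is pure if all facets have the same cardinality; its dimension is the maximum facet dimension. $\langle F_1,\dots,F_k\rangle$ denotes the complex whose facets are $F_1,\dots,F_k$. For a complex $\mathcal{C}$ and sets $G_1,\dots,G_k$ of the same dimension as $\mathcal{C}$, $\mathcal{C}+\langle G_1,\dots,G_k\rangle$ denotes the complex generated by the facets of $\mathcal{C}$ together with $G_1,\dots,G_k$. For a nonempty face $F$ of $\mathcal{C}$: the link is $\mathrm{lk}_F\mathcal{C}=\{G\in\mathcal{C}: G\cap F=\emptyset,\ G\cup F\in\mathcal{C}\}$ and the deletion is $\mathrm{del}_F\mathcal{C}=\{G\in\mathcal{C}: F\not\subseteq G\}$. A pure $d$-dimensional complex $\mathcal{C}$ is $k$-decomposable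 if either $\mathcal{C}$ is a simplex (has exactly one facet), or there is a face $F$ of $\mathcal{C}$ with $\dim F\le k$ such that $\mathrm{del}_F\mathcal{C}$ and $\mathrm{lk}_F\mathcal{C}$ are both $k$-decomposable and $\mathrm{del}_F\mathcal{C}$ is pure of the same dimension $d$ as $\mathcal{C}$ (a face satisfying this last purity condition is called a shedding face). *)

theory Defs
  imports Main
begin

definition simplicial_complex :: "'a set set \<Rightarrow> bool" where
  "simplicial_complex C \<longleftrightarrow>
     (\<exists>V. finite V \<and> C \<subseteq> Pow V) \<and> (\<forall>F\<in>C. \<forall>G. G \<subseteq> F \<longrightarrow> G \<in> C)"

definition vertices :: "'a set set \<Rightarrow> 'a set" where
  "vertices C = {v. {v} \<in> C}"

definition facets :: "'a set set \<Rightarrow> 'a set set" where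
  "facets C = {F \<in> C. \<forall>G\<in>C. F \<subseteq> G \<longrightarrow> G = F}"

text \<open>Dimensions are integers, so that the empty face and the complex \<open>{{}}\<close> have dimension \<open>-1\<close>.\<close>

definition face_dim :: "'a set \<Rightarrow> int" where
  "face_dim F = int (card F) - 1"

text \<open>Unspecified for the complex without faces; the statements below never depend on that
  value, because that complex is not decomposable and is never a deletion of a nonempty face.\<close>

definition complex_dim :: "'a set set \<Rightarrow> int" where
  "complex_dim C = Max (face_dim ` facets C)"

definition pure_complex :: "'a set set \<Rightarrow> bool" where
  "pure_complex C \<longleftrightarrow> (\<forall>F\<in>facets C. \<forall>G\<in>facets C. card F = card G)"

definition is_simplex :: "'a set set \<Rightarrow> bool" where
  "is_simplex C \<longleftrightarrow> (\<exists>!F. F \<in> facets C)"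

definition generated_complex :: "'a set set \<Rightarrow> 'a set set" where
  "generated_complex X = {G. \<exists>F\<in>X. G \<subseteq> F}"

text \<open>\<open>add_facets C {G\<^sub>1, \<dots>, G\<^sub>k}\<close> is \<open>C + \<langle>G\<^sub>1, \<dots>, G\<^sub>k\<rangle>\<close>.\<close>

definition add_facets :: "'a set set \<Rightarrow> 'a set set \<Rightarrow> 'a set set" where
  "add_facets C X = generated_complex (facets C \<union> X)"

definition skeleton :: "nat \<Rightarrow> 'a set set \<Rightarrow> 'a set set" where
  "skeleton d C = {F \<in> C. face_dim F \<le> int d}"

definition link :: "'a set \<Rightarrow> 'a set set \<Rightarrow> 'a set set" where
  "link F C = {G \<in> C. G \<inter> F = {} \<and> G \<union> F \<in> C}"

definition deletion :: "'a set \<Rightarrow> 'a set set \<Rightarrow> 'a set set" where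
  "deletion F C = {G \<in> C. \<not> F \<subseteq> G}"

definition shedding_face :: "'a set set \<Rightarrow> 'a set \<Rightarrow> bool" where
  "shedding_face C F \<longleftrightarrow> F \<in> C \<and> F \<noteq> {} \<and>
     pure_complex (deletion F C) \<and> complex_dim (deletion F C) = complex_dim C"

text \<open>For a nonempty face \<open>F\<close> of a finite complex, link and deletion have strictly fewer faces,
  so this inductive definition is the usual recursive one.\<close>

inductive decomposable :: "nat \<Rightarrow> 'a set set \<Rightarrow> bool" for k :: nat where
  simplex: "simplicial_complex C \<Longrightarrow> pure_complex C \<Longrightarrow> is_simplex C \<Longrightarrow> decomposable k C"
| shed: "simplicial_complex C \<Longrightarrow> pure_complex C \<Longrightarrow>
    shedding_face C F \<Longrightarrow> face_dim F \<le> int k \<Longrightarrow>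
    decomposable k (deletion F C) \<Longrightarrow> decomposable k (link F C) \<Longrightarrow> decomposable k C"

lemma not_decomposable_empty: "\<not> decomposable k {}"
  by (auto elim: decomposable.cases simp: is_simplex_def facets_def shedding_face_def)

lemma facets_skeleton_Pow:
  assumes "finite V" "d + 1 \<le> card V"
  shows "facets (skeleton d (Pow V)) = {F. F \<subseteq> V \<and> card F = d + 1}"
proof -
  have mem: "F \<in> skeleton d (Pow V) \<longleftrightarrow> F \<subseteq> V \<and> card F \<le> d + 1" for F
    by (auto simp: skeleton_def face_dim_def)
  have "card F = d + 1" if F: "F \<in> facets (skeleton d (Pow V))" for F
  proof (rule ccontr)
    assume ne: "card F \<noteq> d + 1"
    have FV: "F \<subseteq> V" "card F \<le> d + 1" using F mem by (auto simp: facets_def)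
    then have lt: "card F < d + 1" using ne by simp
    then have "F \<noteq> V" using assms(2) by auto
    then obtain x where x: "x \<in> V" "x \<notin> F" using FV by blast
    have "finite F" using FV assms(1) finite_subset by blast
    then have "insert x F \<in> skeleton d (Pow V)" using x FV lt by (auto simp: mem)
    then have "insert x F = F" using F unfolding facets_def by blast
    then show False using x by blast
  qed
  moreover have "F \<in> facets (skeleton d (Pow V))" if "F \<subseteq> V" "card F = d + 1" for F
  proof -
    have "G = F" if "G \<subseteq> V" "card G \<le> d + 1" "F \<subseteq> G" for G
      using that \<open>card F = d + 1\<close> assms(1)
      by (metis card_seteq finite_subset)
    then show ?thesis using that by (auto simp: facets_def mem)
  qed
  ultimately show ?thesis by (auto simp: facets_def mem)
qed

end

theory Submission
  imports Defs
begin

text \<open>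
  The key observation is that a complex which can be decomposed without ever shedding a face that
  meets \<open>H\<close> stays decomposable when all facets \<open>A \<union> B\<close> are added, where \<open>A\<close> is a minimal nonface
  disjoint from \<open>H\<close> and \<open>B\<close> ranges over a decomposable family of subsets of \<open>H\<close>; there is no bound
  on the size of \<open>A\<close>, because the old shedding faces keep working. The new vertices
  are first attached one at a time, along the codimension-one skeleton of what is already there;
  this yields the \<open>d\<close>-skeleton of the join of \<open>C\<close> with the simplex on \<open>H\<close>, which has such a
  decomposition. Then each missing edge \<open>{y, v}\<close> of \<open>C\<close> is added by a facet \<open>{y, w, v} \<union> H\<close>, shedding
  the edge itself, and the remaining facets \<open>F\<close> are added by increasing size of \<open>A = F - H\<close>. Every
  facet has \<open>|A| \<ge> 3\<close> since \<open>|H| = d - 2\<close>, and once all edges are present, minimality of \<open>|A|\<close> makes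
  \<open>A\<close> a minimal nonface with all required boundary faces.
\<close>

section \<open>Facet families decomposable without shedding a face that meets
  \<open>H\<close>\<close>

abbreviation subsets_of_card :: "'a set \<Rightarrow> nat \<Rightarrow> 'a set set" where
  "subsets_of_card W m \<equiv> {F. F \<subseteq> W \<and> card F = m}"

text \<open>
  \<open>X\<close> is the set of facets of a pure complex of dimension \<open>m - 1\<close>; in the rule \<open>shed\<close>, the families
  \<open>Y\<close> and \<open>L\<close> are the facets of the deletion and of the link of \<open>e\<close>, and the last premise is
  the purity of the deletion. No shedding face meets \<open>H\<close>, and the base cases are chosen such that
  every \<open>m\<close>-subset of \<open>H\<close> belongs to \<open>X\<close>. For \<open>H = {}\<close> this is \<open>k\<close>-decomposability.
\<close>

inductive shed_dec :: "nat \<Rightarrow> 'a set \<Rightarrow> nat \<Rightarrow> 'a set set \<Rightarrow> bool" for k :: nat and H :: "'a set" where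
  single: "finite F \<Longrightarrow> H \<subseteq> F \<Longrightarrow> card F = m \<Longrightarrow> shed_dec k H m {F}"
| full: "finite H \<Longrightarrow> m \<le> card H \<Longrightarrow> shed_dec k H m (subsets_of_card H m)"
| shed: "shed_dec k H m Y \<Longrightarrow> shed_dec k H l L \<Longrightarrow>
    finite e \<Longrightarrow> e \<noteq> {} \<Longrightarrow> card e \<le> k + 1 \<Longrightarrow> e \<inter> H = {} \<Longrightarrow> m = l + card e \<Longrightarrow>
    (\<And>F. F \<in> Y \<Longrightarrow> \<not> e \<subseteq> F) \<Longrightarrow> (\<And>G. G \<in> L \<Longrightarrow> G \<inter> e = {}) \<Longrightarrow>
    (\<And>G u. G \<in> L \<Longrightarrow> u \<in> e \<Longrightarrow> \<exists>F\<in>Y. G \<union> (e - {u}) \<subseteq> F) \<Longrightarrow>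
    shed_dec k H m (Y \<union> (\<union>) e ` L)"

lemma ex_subset_of_card:
  assumes "finite W" "m \<le> card W"
  shows "\<exists>F. F \<in> subsets_of_card W m"
  using obtain_subset_with_card_n[OF assms(2)] by blast

lemma ex_superset_of_card:
  assumes "finite W" "G \<subseteq> W" "card G \<le> m" "m \<le> card W"
  shows "\<exists>F \<in> subsets_of_card W m. G \<subseteq> F"
proof -
  have fG: "finite G" using assms finite_subset by blast
  have "m - card G \<le> card (W - G)"
    using assms fG by (simp add: card_Diff_subset)
  then obtain T where T: "T \<subseteq> W - G" "card T = m - card G" "finite T"
    using obtain_subset_with_card_n by metis
  have "card (G \<union> T) = m"
    using T fG assms(3) by (subst card_Un_disjoint) auto
  then show ?thesis using T assms(2) by blast
qed

lemma shed_dec_uniform: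
  assumes "shed_dec k H m X"
  shows "finite X" "X \<noteq> {}" "\<And>F. F \<in> X \<Longrightarrow> finite F \<and> card F = m"
proof -
  have "finite X \<and> X \<noteq> {} \<and> (\<forall>F\<in>X. finite F \<and> card F = m)"
    using assms
  proof induction
    case (full m)
    then show ?case using ex_subset_of_card[of H m] finite_subset by auto
  next
    case (shed m Y l L e)
    have "card (e \<union> G) = m" if "G \<in> L" for G
      using shed that by (subst card_Un_disjoint) auto
    then show ?case using shed by auto
  qed auto
  then show "finite X" "X \<noteq> {}" "\<And>F. F \<in> X \<Longrightarrow> finite F \<and> card F = m" by auto
qed

text \<open>The vertices of \<open>W - H\<close> are shed one at a time: deletion and link of
  \<open>w\<close> are again complete families, on \<open>W - {w}\<close>.\<close>

lemma shed_dec_subsets_of_card: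
  assumes "finite W" "H \<subseteq> W" "m \<le> card W"
  shows "shed_dec k H m (subsets_of_card W m)"
proof -
  have "finite (W - H)" using assms by simp
  then show ?thesis using assms
  proof (induction "card (W - H)" arbitrary: W m)
    case 0
    then have "W = H" by auto
    then show ?case using 0 shed_dec.full by auto
  next
    case (Suc c)
    show ?case
    \<comment> \<open>No vertex can be shed at the two extremes: for \<open>m = 0\<close> there is
      no link of smaller facet size, and for \<open>m = card W\<close> the deletion has no
      \<open>m\<close>-subset left.\<close>
    proof (cases "m = 0 \<or> m = card W")
      case True
      then show ?thesis
      proof
        assume "m = 0"
        moreover have "subsets_of_card W 0 = subsets_of_card H 0"
          using Suc.prems by (auto simp: finite_subset card_eq_0_iff)
        moreover have "finite H" using Suc.prems finite_subset by blast
        ultimately show ?thesis using shed_dec.full[of H 0 k] by simp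
      next
        assume m: "m = card W"
        have "subsets_of_card W m = {W}"
          using Suc.prems m card_subset_eq by auto
        then show ?thesis using shed_dec.single[of W H m] m Suc.prems by simp
      qed
    next
      case False
      obtain w where w: "w \<in> W" "w \<notin> H" using Suc.hyps(2)
        by (metis DiffD1 DiffD2 card.empty ex_in_conv nat.distinct(1))
      let ?W = "W - {w}"
      have cW: "card ?W = card W - 1" using w Suc.prems by simp
      have "W - {w} - H = W - H - {w}" by auto
      then have c: "c = card (?W - H)"
        using w Suc.hyps(2) Suc.prems by simp
      have del: "shed_dec k H m (subsets_of_card ?W m)"
        by (rule Suc.hyps(1)[OF c]) (use Suc.prems w False cW in auto)
      have lk: "shed_dec k H (m - 1) (subsets_of_card ?W (m - 1))"
        by (rule Suc.hyps(1)[OF c]) (use Suc.prems w False cW in auto)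
      have fin: "finite G" if "G \<subseteq> W" for G using that Suc.prems finite_subset by auto
      have eq: "subsets_of_card W m
          = subsets_of_card ?W m \<union> (\<union>) {w} ` subsets_of_card ?W (m - 1)" (is "?l = ?r")
      proof
        show "?l \<subseteq> ?r"
        proof
          fix F assume F: "F \<in> ?l"
          show "F \<in> ?r"
          proof (cases "w \<in> F")
            case True
            then have "F = {w} \<union> (F - {w})" "F - {w} \<in> subsets_of_card ?W (m - 1)"
              using F fin by auto
            then show ?thesis by blast
          qed (use F in auto)
        qed
        show "?r \<subseteq> ?l"
        proof
          fix F assume F: "F \<in> ?r"
          have "card (insert w G) = m" if "G \<subseteq> ?W" "card G = m - 1" for G
          proof -
            have "w \<notin> G" "finite G" using that fin by auto
            then show ?thesis using that False by simp
          qed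
          then show "F \<in> ?l" using F w by auto
        qed
      qed
      have nb: "\<exists>F\<in>subsets_of_card ?W m. G \<union> ({w} - {u}) \<subseteq> F"
        if "G \<in> subsets_of_card ?W (m - 1)" "u \<in> {w}" for G u
        using ex_superset_of_card[of ?W G m] that Suc.prems False cW by auto
      show ?thesis unfolding eq
        by (rule shed_dec.shed[OF del lk _ _ _ _ _ _ _ nb]) (use w False in auto)
    qed
  qed
qed

text \<open>Shrinking \<open>H\<close> relaxes the conditions on shed faces and simplices; only the
  base case \<open>full\<close> changes, where vertices of \<open>H - H'\<close> are now
  shed.\<close>

lemma shed_dec_antimono:
  assumes "shed_dec k H m X" "H' \<subseteq> H"
  shows "shed_dec k H' m X"
  using assms
proof induction
  case (single F m)
  then show ?case using shed_dec.single[of F H' m] by auto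
next
  case (full m)
  then show ?case using shed_dec_subsets_of_card[of H H' m] by auto
next
  case (shed m Y l L e)
  show ?case
    by (rule shed_dec.shed[OF shed.IH(1) shed.IH(2)]) (use shed in auto)
qed

text \<open>
  A shedding face \<open>e\<close> of the old complex remains one: if \<open>e \<subseteq> A\<close> then the new facets only change the
  link of \<open>e\<close>, where \<open>A - e\<close> takes the role of \<open>A\<close>; otherwise they only change the deletion. In the
  base cases \<open>A\<close> is forced to be a single new vertex.
\<close>

lemma shed_dec_attach:
  assumes "shed_dec k H m X" "shed_dec k H' l L" "H' \<subseteq> H" "L \<subseteq> Pow H"
    and "finite A" "A \<inter> H = {}" "m = l + card A"
    and "\<And>F. F \<in> X \<Longrightarrow> \<not> A \<subseteq> F"
    and "\<And>B x. B \<in> L \<Longrightarrow> x \<in> A \<Longrightarrow> \<exists>F\<in>X. A - {x} \<union> B \<subseteq> F"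
  shows "shed_dec k H' m (X \<union> (\<union>) A ` L)"
proof -
  obtain B0 where B0: "B0 \<in> L" using shed_dec_uniform(2)[OF assms(2)] by auto
  \<comment> \<open>A single vertex may be shed for every \<open>k\<close>: here \<open>A\<close>
    itself is the shed face, with deletion \<open>X\<close> and link \<open>L\<close>.\<close>
  have vertex: "shed_dec k H' m (X \<union> (\<union>) A ` L)"
    if "shed_dec k H m X" "finite A" "A \<inter> H = {}" "m = l + card A" "A = {x}"
      "\<And>F. F \<in> X \<Longrightarrow> \<not> A \<subseteq> F"
      "\<And>B x. B \<in> L \<Longrightarrow> x \<in> A \<Longrightarrow> \<exists>F\<in>X. A - {x} \<union> B \<subseteq> F" for X m A x
    by (rule shed_dec.shed[OF shed_dec_antimono[OF that(1) assms(3)] assms(2)])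
      (use that assms(3,4) in \<open>auto simp: Un_commute\<close>)
  show ?thesis using assms(1,5-)
  proof (induction arbitrary: A)
    case (single F m)
    obtain x where x: "x \<in> A" using single.prems(4)[of F] by auto
    \<comment> \<open>For \<open>y \<noteq> x\<close>, \<open>A\<close> would be the union of
      \<open>A - {x}\<close> and \<open>A - {y}\<close>, both inside the only facet
      \<open>F\<close>.\<close>
    have "A \<subseteq> {x}"
    proof
      fix y assume "y \<in> A"
      have "A - {x} \<subseteq> F" "A - {y} \<subseteq> F"
        using single.prems(5)[OF B0 x] single.prems(5)[OF B0 \<open>y \<in> A\<close>] by auto
      then show "y \<in> {x}" using single.prems(4)[of F] by auto
    qed
    then have "A = {x}" using x by auto
    then show ?case
      by (intro vertex[OF shed_dec.single[OF single.hyps]]) (use single.prems in auto)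
  next
    case (full m)
    have "A \<noteq> {}" using full.prems(4) ex_subset_of_card[OF full.hyps] by blast
    then obtain x where x: "x \<in> A" by auto
    have "A - {x} \<subseteq> H" using full.prems(5)[OF B0 x] by auto
    then have "A = {x}" using x full.prems(2) by auto
    then show ?case
      by (intro vertex[OF shed_dec.full[OF full.hyps] full.prems(1-3) _ full.prems(4,5)])
  next
    case (shed m Y M' M e)
    note nonface = shed.prems(4) and nb = shed.prems(5)
    \<comment> \<open>A set \<open>Z\<close> that omits a vertex \<open>u\<close> of
      \<open>e\<close> lies in the deletion: the purity premise for \<open>u\<close> puts it under a
      facet in \<open>Y\<close>.\<close>
    have Y: "\<exists>F\<in>Y. Z \<subseteq> F" if "F \<in> Y \<union> (\<union>) e ` M" "Z \<subseteq> F" "\<not> e \<subseteq> Z" for F Z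
    proof (cases "F \<in> Y")
      case False
      then obtain G where G: "G \<in> M" "F = e \<union> G" using \<open>F \<in> Y \<union> _\<close> by auto
      obtain u where u: "u \<in> e" "u \<notin> Z" using \<open>\<not> e \<subseteq> Z\<close> by auto
      have "Z \<subseteq> G \<union> (e - {u})" using G u that by auto
      then show ?thesis using shed.hyps(10)[OF G(1) u(1)] by blast
    qed (use that in auto)
    have Le: "B \<inter> e = {}" if "B \<in> L" for B using that assms(4) shed.hyps(6) by auto
    show ?case
    proof (cases "e \<subseteq> A")
      case True
      have "card A = card e + card (A - e)"
        using True shed.prems(1) by (metis card_Diff_subset card_mono finite_subset le_add_diff_inverse)
      then have c: "M' = l + card (A - e)" using shed.hyps(7) shed.prems(3) by simp
      have IH: "shed_dec k H' M' (M \<union> (\<union>) (A - e) ` L)"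
      proof (rule shed.IH(2)[OF _ _ c])
        fix G assume "G \<in> M"
        then have "\<not> A \<subseteq> e \<union> G" by (intro nonface) blast
        then show "\<not> A - e \<subseteq> G" by blast
      next
        fix B x assume B: "B \<in> L" and x: "x \<in> A - e"
        then obtain F where F: "F \<in> Y \<union> (\<union>) e ` M" "A - {x} \<union> B \<subseteq> F" using nb[OF B, of x] by blast
        then have "e \<subseteq> F" using True x by auto
        then obtain G where G: "G \<in> M" "F = e \<union> G" using F shed.hyps(8) by auto
        then have "A - e - {x} \<union> B \<subseteq> G" using F Le[OF B] by auto
        then show "\<exists>F\<in>M. A - e - {x} \<union> B \<subseteq> F" using G by blast
      qed (use shed.prems(1,2) in auto)
      have "A \<union> B = e \<union> (A - e \<union> B)" for B using True by auto
      then have "Y \<union> (\<union>) e ` M \<union> (\<union>) A ` L = Y \<union> (\<union>) e ` (M \<union> (\<union>) (A - e) ` L)"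
        by (simp add: image_Un image_image Un_assoc)
      moreover have "shed_dec k H' m \<dots>"
      proof (rule shed_dec.shed[OF shed_dec_antimono[OF shed.hyps(1) assms(3)] IH])
        fix G u assume G: "G \<in> M \<union> (\<union>) (A - e) ` L" and u: "u \<in> e"
        show "\<exists>F\<in>Y. G \<union> (e - {u}) \<subseteq> F"
        proof (cases "G \<in> M")
          case False
          then obtain B where B: "B \<in> L" "G = A - e \<union> B" using G by auto
          \<comment> \<open>This boundary face of \<open>A \<union> B\<close> lies under an old
            facet by \<open>nb\<close> and omits \<open>u\<close>, so it lies in the
            deletion.\<close>
          then have "G \<union> (e - {u}) = A - {u} \<union> B" using True u by auto
          moreover obtain F where "F \<in> Y \<union> (\<union>) e ` M" "A - {u} \<union> B \<subseteq> F"
            using nb[OF B(1), of u] True u by blast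
          moreover have "\<not> e \<subseteq> A - {u} \<union> B" using u Le[OF B(1)] by auto
          ultimately show ?thesis using Y by metis
        qed (use shed.hyps(10) u in auto)
      next
        show "\<not> e \<subseteq> F" if "F \<in> Y" for F using shed.hyps(8) that .
        show "G \<inter> e = {}" if "G \<in> M \<union> (\<union>) (A - e) ` L" for G
          using that shed.hyps(9) Le by fast
      qed (use shed.hyps(3-7) assms(3) in auto)
      ultimately show ?thesis by simp
    next
      case False
      \<comment> \<open>Since \<open>B\<close> is disjoint from \<open>e\<close>, the new facets do
        not contain \<open>e\<close>; they enlarge the deletion and leave the link
        unchanged.\<close>
      have neA: "\<not> e \<subseteq> A \<union> B" if "B \<in> L" for B using False Le[OF that] by auto
      have IH: "shed_dec k H' m (Y \<union> (\<union>) A ` L)"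
      proof (rule shed.IH(1))
        fix B x assume B: "B \<in> L" and x: "x \<in> A"
        then obtain F where "F \<in> Y \<union> (\<union>) e ` M" "A - {x} \<union> B \<subseteq> F" using nb[OF B x] by blast
        moreover have "\<not> e \<subseteq> A - {x} \<union> B" using neA[OF B] by auto
        ultimately show "\<exists>F\<in>Y. A - {x} \<union> B \<subseteq> F" using Y by blast
      qed (use shed.prems(1-4) in auto)
      have "Y \<union> (\<union>) e ` M \<union> (\<union>) A ` L = Y \<union> (\<union>) A ` L \<union> (\<union>) e ` M" by auto
      moreover have "shed_dec k H' m \<dots>"
      proof (rule shed_dec.shed[OF IH shed_dec_antimono[OF shed.hyps(2) assms(3)]])
        show "\<not> e \<subseteq> F" if "F \<in> Y \<union> (\<union>) A ` L" for F
          using that shed.hyps(8) neA by blast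
        show "G \<inter> e = {}" if "G \<in> M" for G using shed.hyps(9) that .
        show "\<exists>F\<in>Y \<union> (\<union>) A ` L. G \<union> (e - {u}) \<subseteq> F" if "G \<in> M" "u \<in> e" for G u
          using shed.hyps(10)[OF that] by blast
      qed (use shed.hyps(3-7) assms(3) in auto)
      ultimately show ?thesis by simp
    qed
  qed
qed


section \<open>Skeletons of joins with a simplex\<close>

text \<open>The facets of the \<open>(m - 1)\<close>-skeleton of the join of \<open>X\<close> with the simplex on \<open>H\<close>.\<close>

definition skel_join :: "'a set \<Rightarrow> nat \<Rightarrow> 'a set set \<Rightarrow> 'a set set" where
  "skel_join H m X = {F. finite F \<and> card F = m \<and> (\<exists>G\<in>X. F - H \<subseteq> G)}"

lemma skel_join_singleton:
  assumes "finite F" "finite H"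
  shows "skel_join H m {F} = subsets_of_card (F \<union> H) m"
proof -
  have "finite G" if "G \<subseteq> F \<union> H" for G using that assms by (meson finite_UnI finite_subset)
  then show ?thesis by (auto simp: skel_join_def)
qed

text \<open>Shedding faces of \<open>X\<close> are kept: joining with \<open>H\<close> and
  truncating commutes with deletion of \<open>e\<close>, and turns the link of \<open>e\<close> into
  its join with \<open>H\<close>, truncated to size \<open>m' - card e\<close>. The case
  \<open>H = {}\<close> covers plain skeletons.\<close>

lemma shed_dec_skel_join:
  assumes "shed_dec k {} m X" "m' \<le> m" "finite H" "\<Union>X \<inter> H = {}"
  shows "shed_dec k H m' (skel_join H m' X)"
  using assms(1,2,4)
proof (induction arbitrary: m')
  case (single F m)
  have "m' \<le> card (F \<union> H)"
    using single assms(3) by (metis card_mono finite_UnI le_trans sup_ge1)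
  then have "shed_dec k H m' (subsets_of_card (F \<union> H) m')"
    using shed_dec_subsets_of_card[of "F \<union> H" H m'] single assms(3) by simp
  then show ?case using skel_join_singleton single assms(3) by metis
next
  case (full m)
  \<comment> \<open>\<open>card {} = 0\<close> forces \<open>m = 0\<close>, so the sole facet is the
    empty face.\<close>
  have eq: "subsets_of_card {} m = {{}}" using full by auto
  have "shed_dec k H m' (subsets_of_card ({} \<union> H) m')"
    using shed_dec_subsets_of_card[of H H m'] full assms(3) by simp
  then show ?case unfolding eq using skel_join_singleton[of "{}" H m'] assms(3) by simp
next
  case (shed m Y l L e)
  have eH: "e \<inter> H = {}" using shed.prems(2) shed_dec_uniform(2)[OF shed.hyps(2)] by auto
  have IHY: "shed_dec k H m' (skel_join H m' Y)"
    by (rule shed.IH(1)) (use shed.prems in auto)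
  have Y: "F \<in> skel_join H m' Y"
    if "F \<in> skel_join H m' (Y \<union> (\<union>) e ` L)" (is ?F) and "\<not> e \<subseteq> F" for F
  proof -
    obtain G where G: "G \<in> Y \<union> (\<union>) e ` L" "F - H \<subseteq> G"
      using \<open>?F\<close> unfolding skel_join_def by blast
    have "\<exists>G\<in>Y. F - H \<subseteq> G"
    proof (cases "G \<in> Y")
      case False
      then obtain G' where G': "G' \<in> L" "G = e \<union> G'" using G by auto
      obtain u where u: "u \<in> e" "u \<notin> F" using \<open>\<not> e \<subseteq> F\<close> by auto
      have "F - H \<subseteq> G' \<union> (e - {u})" using G G' u by auto
      then show ?thesis using shed.hyps(10)[OF G'(1) u(1)] by (meson order_trans)
    qed (use G in auto)
    then show ?thesis using that(1) by (auto simp: skel_join_def)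
  qed
  have Y': "F \<in> skel_join H m' (Y \<union> (\<union>) e ` L)" if "F \<in> skel_join H m' Y" for F
    using that by (auto simp: skel_join_def)
  show ?case
  proof (cases "card e \<le> m'")
    \<comment> \<open>A face with more than \<open>m'\<close> elements does not survive in the
      skeleton, so nothing is shed.\<close>
    case False
    have "\<not> e \<subseteq> F" if "F \<in> skel_join H m' (Y \<union> (\<union>) e ` L)" for F
      using that False card_mono[of F e] by (auto simp: skel_join_def)
    then have "skel_join H m' (Y \<union> (\<union>) e ` L) = skel_join H m' Y"
      using Y Y' by blast
    then show ?thesis using IHY by simp
  next
    case True
    let ?L = "skel_join H (m' - card e) L"
    have "\<Union>L \<inter> H = {}" using shed.prems(2) by blast
    then have IHL: "shed_dec k H (m' - card e) ?L"
      by (intro shed.IH(2)) (use shed.prems(1) shed.hyps(7) in auto)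
    have L: "finite G \<and> G \<inter> e = {} \<and> card G = m' - card e \<and> (\<exists>G'\<in>L. G - H \<subseteq> G')"
      if G: "G \<in> ?L" for G
    proof -
      obtain G' where "G' \<in> L" "G - H \<subseteq> G'" using G by (auto simp: skel_join_def)
      then have "G \<inter> e = {}" using shed.hyps(9)[of G'] eH by blast
      then show ?thesis using G by (auto simp: skel_join_def)
    qed
    have "skel_join H m' (Y \<union> (\<union>) e ` L) = skel_join H m' Y \<union> (\<union>) e ` ?L" (is "?l = ?r")
    proof
      show "?l \<subseteq> ?r"
      proof
        fix F assume F: "F \<in> ?l"
        show "F \<in> ?r"
        proof (cases "e \<subseteq> F")
          case True
          obtain G where G: "G \<in> Y \<union> (\<union>) e ` L" "F - H \<subseteq> G"
            using F unfolding skel_join_def by blast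
          then have "e \<subseteq> G" using True eH by auto
          then obtain G' where G': "G' \<in> L" "G = e \<union> G'" using G shed.hyps(8) by auto
          have "F - e - H \<subseteq> G'" using G G' by auto
          moreover have "finite F" "card F = m'" using F by (auto simp: skel_join_def)
          ultimately have "F - e \<in> ?L"
            using G'(1) True shed.hyps(3) by (auto simp: skel_join_def card_Diff_subset)
          moreover have "F = e \<union> (F - e)" using True by auto
          ultimately show ?thesis by blast
        qed (use F Y in blast)
      qed
      have "e \<union> G \<in> ?l" if G: "G \<in> ?L" for G
      proof -
        obtain G' where "G' \<in> L" "G - H \<subseteq> G'" using L[OF G] by blast
        then have "e \<union> G' \<in> Y \<union> (\<union>) e ` L" "e \<union> G - H \<subseteq> e \<union> G'" by auto
        moreover have "card (e \<union> G) = m'"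
          using L[OF G] True shed.hyps(3) by (subst card_Un_disjoint) auto
        ultimately show ?thesis unfolding skel_join_def using L[OF G] shed.hyps(3) by blast
      qed
      then show "?r \<subseteq> ?l" using Y' by blast
    qed
    moreover have "shed_dec k H m' \<dots>"
    proof (rule shed_dec.shed[OF IHY IHL])
      show "\<not> e \<subseteq> F" if "F \<in> skel_join H m' Y" for F
      proof -
        obtain G where "G \<in> Y" "F - H \<subseteq> G" using \<open>F \<in> _\<close> by (auto simp: skel_join_def)
        then show ?thesis using shed.hyps(8)[of G] eH by blast
      qed
      \<comment> \<open>The set has at most \<open>m'\<close> elements and lies in
        \<open>F \<union> H\<close> for some \<open>F\<close> in \<open>Y\<close>; as
        \<open>card F = m \<ge> m'\<close>, it extends to an \<open>m'\<close>-subset there.\<close>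
      show "\<exists>F\<in>skel_join H m' Y. G \<union> (e - {u}) \<subseteq> F" if G: "G \<in> ?L" and u: "u \<in> e" for G u
      proof -
        obtain G' where G': "G' \<in> L" "G - H \<subseteq> G'" using L[OF G] by blast
        obtain F where F: "F \<in> Y" "G' \<union> (e - {u}) \<subseteq> F" using shed.hyps(10)[OF G'(1) u] by blast
        have cF: "finite F" "card F = m" using shed_dec_uniform(3)[OF shed.hyps(1) F(1)] by auto
        have "card (G \<union> (e - {u})) = m' - card e + card (e - {u})"
          using L[OF G] shed.hyps(3) by (subst card_Un_disjoint) auto
        also have "\<dots> \<le> m'"
          using True card_Diff1_le[of e u] by linarith
        finally have c: "card (G \<union> (e - {u})) \<le> m'" .
        have "m' \<le> card (F \<union> H)"
          using cF shed.prems(1) assms(3) by (metis card_mono finite_UnI le_trans sup_ge1)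
        then obtain F' where "F' \<in> subsets_of_card (F \<union> H) m'" "G \<union> (e - {u}) \<subseteq> F'"
          using ex_superset_of_card[of "F \<union> H" "G \<union> (e - {u})" m'] c cF assms(3) F(2) G'(2)
          by blast
        moreover then have "F' \<in> skel_join H m' Y"
          using F(1) cF assms(3) skel_join_singleton[of F H m'] by (auto simp: skel_join_def)
        ultimately show ?thesis by blast
      qed
      show "G \<inter> e = {}" if "G \<in> ?L" for G using L[OF that] by blast
    qed (use shed.hyps(3-5) eH True in auto)
    ultimately show ?thesis by simp
  qed
qed

section \<open>Adding facets one at a time\<close>

text \<open>Decomposability is demanded after each insertion but not of \<open>X\<close> itself, so
  a chain may start from the empty family.\<close>

definition grow :: "nat \<Rightarrow> nat \<Rightarrow> 'a set set \<Rightarrow> 'a set set \<Rightarrow> bool" where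
  "grow k m = (\<lambda>X Y. \<exists>F. F \<notin> X \<and> Y = insert F X \<and> shed_dec k {} m Y)\<^sup>*\<^sup>*"

lemma grow_refl [simp]: "grow k m X X"
  by (simp add: grow_def)

lemma grow_trans: "grow k m X Y \<Longrightarrow> grow k m Y Z \<Longrightarrow> grow k m X Z"
  unfolding grow_def by (rule rtranclp_trans)

lemma grow_insert: "shed_dec k {} m (insert F X) \<Longrightarrow> grow k m X (insert F X)"
  by (cases "F \<in> X") (auto simp: grow_def insert_absorb)

lemma grow_subset: "grow k m X Y \<Longrightarrow> X \<subseteq> Y"
  unfolding grow_def by (induction rule: rtranclp_induct) auto

lemma grow_induct [consumes 1, case_names refl insert]:
  assumes "grow k m X Y" "P X"
    and "\<And>Y F. grow k m X Y \<Longrightarrow> P Y \<Longrightarrow> F \<notin> Y \<Longrightarrow> shed_dec k {} m (insert F Y) \<Longrightarrow> P (insert F Y)"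
  shows "P Y"
  using assms(1) unfolding grow_def
  by (induction rule: rtranclp_induct) (use assms(2,3) in \<open>auto simp: grow_def\<close>)

text \<open>Lifts an order in which a link can be built to an order for the facets containing
  \<open>A\<close>; the second premise covers the partial links on the way.\<close>

lemma grow_attach:
  assumes "grow k l L0 L"
    and "\<And>L'. L' \<subseteq> L \<Longrightarrow> shed_dec k {} l L' \<Longrightarrow> shed_dec k {} m (X \<union> (\<union>) A ` L')"
  shows "grow k m (X \<union> (\<union>) A ` L0) (X \<union> (\<union>) A ` L)"
  using assms
proof (induction rule: grow_induct)
  case (insert L F)
  have "grow k m (X \<union> (\<union>) A ` L) (insert (A \<union> F) (X \<union> (\<union>) A ` L))"
    using grow_insert[of k m "A \<union> F"] insert.prems[OF order.refl insert.hyps(3)] by simp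
  moreover have "grow k m (X \<union> (\<union>) A ` L0) (X \<union> (\<union>) A ` L)"
    by (rule insert.IH) (use insert.prems in blast)
  ultimately show ?case using grow_trans by (metis Un_insert_right image_insert)
qed simp

text \<open>The deletion is built first, then the facets of the link joined with \<open>e\<close>.
  Partial links satisfy the premises of \<open>shed\<close>, since these concern one link facet at a
  time.\<close>

lemma grow_empty: "shed_dec k {} m X \<Longrightarrow> grow k m {} X"
proof (induction rule: shed_dec.induct)
  case (single F m)
  then show ?case using grow_insert shed_dec.single by metis
next
  case (full m)
  then have eq: "subsets_of_card {} m = {{}}" by auto
  show ?case
    using shed_dec.full[OF full, of k] unfolding eq by (rule grow_insert)
next
  case (shed m Y l L e)
  have "grow k m (Y \<union> (\<union>) e ` {}) (Y \<union> (\<union>) e ` L)"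
  proof (rule grow_attach[OF shed.IH(2)])
    show "shed_dec k {} m (Y \<union> (\<union>) e ` L')" if "L' \<subseteq> L" "shed_dec k {} l L'" for L'
      by (rule shed_dec.shed[OF shed.hyps(1) that(2) shed.hyps(3-8)]) (use that shed.hyps(9,10) in auto)
  qed
  then show ?case using shed.IH(1) grow_trans by auto
qed

text \<open>The vertices of \<open>H\<close> are attached successively. A new vertex
  \<open>h\<close> is itself shed: its deletion is the current complex, and its link grows up to the
  codimension-one skeleton of that complex.\<close>

lemma grow_skel_join:
  assumes "finite H" "shed_dec k {} (Suc m) X" "\<Union>X \<inter> H = {}"
  shows "grow k (Suc m) X (skel_join H (Suc m) X)"
  using assms
proof (induction H)
  case empty
  have "skel_join {} (Suc m) X = X"
  proof
    show "X \<subseteq> skel_join {} (Suc m) X"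
      using shed_dec_uniform(3)[OF empty(1)] by (auto simp: skel_join_def)
    have "F \<in> X" if "G \<in> X" "F \<subseteq> G" "card F = Suc m" for F G
      using shed_dec_uniform(3)[OF empty(1) that(1)] that card_subset_eq by metis
    then show "skel_join {} (Suc m) X \<subseteq> X" by (auto simp: skel_join_def)
  qed
  then show ?case by simp
next
  case (insert h H)
  let ?X = "skel_join H (Suc m) X"
  have IH: "grow k (Suc m) X ?X" using insert by auto
  have "shed_dec k H (Suc m) ?X"
    using shed_dec_skel_join[OF insert.prems(1), of "Suc m" H] insert by auto
  then have X: "shed_dec k {} (Suc m) ?X" using shed_dec_antimono by blast
  have hX: "h \<notin> F" if "F \<in> ?X" for F using that insert by (auto simp: skel_join_def)
  \<comment> \<open>Joining with the empty simplex, \<open>skel_join {} m ?X\<close> is the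
    codimension-one skeleton of \<open>?X\<close>.\<close>
  have lk: "shed_dec k {} m (skel_join {} m ?X)"
    by (rule shed_dec_skel_join[OF X]) auto
  have "grow k (Suc m) (?X \<union> (\<union>) {h} ` {}) (?X \<union> (\<union>) {h} ` skel_join {} m ?X)"
  proof (rule grow_attach[OF grow_empty[OF lk]])
    show "shed_dec k {} (Suc m) (?X \<union> (\<union>) {h} ` L')"
      if "L' \<subseteq> skel_join {} m ?X" "shed_dec k {} m L'" for L'
    proof (rule shed_dec.shed[OF X that(2)])
      show "G \<inter> {h} = {}" if "G \<in> L'" for G
        using that \<open>L' \<subseteq> _\<close> hX by (fastforce simp: skel_join_def[of "{}"])
      show "\<exists>F\<in>?X. G \<union> ({h} - {u}) \<subseteq> F" if "G \<in> L'" "u \<in> {h}" for G u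
        using that \<open>L' \<subseteq> _\<close> by (auto simp: skel_join_def[of "{}"])
    qed (use hX in auto)
  qed
  moreover have "?X \<union> (\<union>) {h} ` skel_join {} m ?X = skel_join (insert h H) (Suc m) X" (is "?l = ?r")
  proof
    show "?l \<subseteq> ?r"
    proof
      fix F assume "F \<in> ?l"
      then show "F \<in> ?r"
      proof
        assume "F \<in> (\<union>) {h} ` skel_join {} m ?X"
        then obtain G G' where G: "F = insert h G" "finite G" "card G = m" "G' \<in> ?X" "G \<subseteq> G'"
          by (auto simp: skel_join_def[of "{}"])
        then have "h \<notin> G" using hX by auto
        moreover obtain G'' where "G'' \<in> X" "G' - H \<subseteq> G''"
          using G(4) by (auto simp: skel_join_def)
        moreover have "F - insert h H \<subseteq> G''" using G calculation by auto
        ultimately show ?thesis using G by (auto simp: skel_join_def)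
      qed (auto simp: skel_join_def)
    qed
    show "?r \<subseteq> ?l"
    proof
      fix F assume F: "F \<in> ?r"
      then obtain G where G: "G \<in> X" "F - insert h H \<subseteq> G" and fF: "finite F" "card F = Suc m"
        by (auto simp: skel_join_def)
      show "F \<in> ?l"
      proof (cases "h \<in> F")
        case False
        then have "F - H \<subseteq> G" using G by auto
        then show ?thesis using G fF by (auto simp: skel_join_def)
      next
        case True
        have cG: "finite G" "card G = Suc m" using shed_dec_uniform(3)[OF insert.prems(1) G(1)] by auto
        have "Suc m \<le> card (G \<union> H)"
          using cG insert.hyps(1) by (metis card_mono finite_UnI sup_ge1)
        moreover have "F - {h} \<subseteq> G \<union> H" "card (F - {h}) \<le> Suc m" using G True fF by auto
        ultimately obtain F' where "F' \<in> subsets_of_card (G \<union> H) (Suc m)" "F - {h} \<subseteq> F'"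
          using ex_superset_of_card[of "G \<union> H" "F - {h}" "Suc m"] cG insert.hyps(1) by auto
        moreover then have "F' \<in> ?X"
          using skel_join_singleton[of G H "Suc m"] cG insert.hyps(1) G(1)
          by (auto simp: skel_join_def)
        moreover have "card (F - {h}) = m" using True fF by simp
        ultimately have "F - {h} \<in> skel_join {} m ?X"
          using fF by (auto simp: skel_join_def[of "{}"])
        moreover have "F = {h} \<union> (F - {h})" using True by auto
        ultimately show ?thesis by blast
      qed
    qed
  qed
  ultimately show ?case using IH grow_trans by auto
qed

section \<open>From the skeleton of the join to the complete family\<close>

text \<open>Each facet \<open>e \<union> G\<close> outside the deletion meets a facet of the
  deletion, because \<open>G \<union> (e - {u})\<close> is nonempty for \<open>m \<ge> 2\<close>.
  With \<open>R\<close> a component, this is connectedness in positive dimension.\<close>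

lemma shed_dec_connected:
  assumes "shed_dec k {} m X" "2 \<le> m" "\<And>F. F \<in> X \<Longrightarrow> F \<subseteq> R \<or> F \<inter> R = {}"
  shows "\<Union>X \<subseteq> R \<or> \<Union>X \<inter> R = {}"
  using assms
proof (induction rule: shed_dec.induct)
  case (shed m Y l L e)
  have "\<Union>Y \<subseteq> R \<or> \<Union>Y \<inter> R = {}" using shed.IH(1) shed.prems by blast
  moreover have "\<exists>F\<in>Y. (e \<union> G) \<inter> F \<noteq> {}" if G: "G \<in> L" for G
  proof -
    obtain u where u: "u \<in> e" using shed.hyps(4) by auto
    obtain F where F: "F \<in> Y" "G \<union> (e - {u}) \<subseteq> F" using shed.hyps(10)[OF G u] by auto
    have "G \<union> (e - {u}) \<noteq> {}"
    proof
      assume "G \<union> (e - {u}) = {}"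
      then have "G = {}" "e = {u}" using u by auto
      then show False
        using shed_dec_uniform(3)[OF shed.hyps(2) G] shed.hyps(7) shed.prems(1) by auto
    qed
    then show ?thesis using F by blast
  qed
  moreover have "e \<union> G \<subseteq> R \<or> (e \<union> G) \<inter> R = {}" if "G \<in> L" for G
    using shed.prems(2)[of "e \<union> G"] that by blast
  ultimately have "(\<Union>Y \<subseteq> R \<and> (\<forall>G\<in>L. e \<union> G \<subseteq> R)) \<or>
      (\<Union>Y \<inter> R = {} \<and> (\<forall>G\<in>L. (e \<union> G) \<inter> R = {}))"
    by (smt (verit, best) Int_iff Union_iff disjoint_iff subset_iff)
  then show ?case by blast
next
  case (single F m)
  then show ?case by auto
next
  case (full m)
  then show ?case by simp
qed

lemma grow_complete:
  assumes X0: "shed_dec k {} m X0" and k: "1 \<le> k" and m: "3 \<le> m"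
    and V: "finite V" "\<Union>X0 = V" and H: "finite H" "card H = m - 3" "V \<inter> H = {}"
  shows "grow k m X0 (subsets_of_card (V \<union> H) m)"
proof -
  let ?S = "subsets_of_card (V \<union> H) m"
  \<comment> \<open>The last clause says that \<open>X\<close> equals
    \<open>skel_join H m X\<close>, so membership depends only on the part outside \<open>H\<close>.
    Decomposability relative to \<open>H\<close> is what \<open>shed_dec_attach\<close>
    consumes.\<close>
  define inv where "inv X \<longleftrightarrow> X0 \<subseteq> X \<and> X \<subseteq> ?S \<and> shed_dec k H m X \<and>
    (\<forall>G\<in>X. \<forall>F\<in>?S. F - H \<subseteq> G \<longrightarrow> F \<in> X)" for X
  have fin: "finite ?S" using V(1) H(1) by simp
  have finF: "finite F" if "F \<in> ?S" for F
    using that V(1) H(1) finite_subset[of F "V \<union> H"] by auto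
  have card3: "3 \<le> card (F - H)" if "F \<in> ?S" for F
  proof -
    have "m - card H \<le> card (F - H)"
      using diff_card_le_card_Diff[OF H(1), of F] that by auto
    then show ?thesis using H(2) m by simp
  qed
  have step: "\<exists>X'. inv X' \<and> X \<subset> X' \<and> grow k m X X'" if X: "inv X" "X \<noteq> ?S" for X
  proof -
    have XS: "X0 \<subseteq> X" "X \<subseteq> ?S" and dec: "shed_dec k H m X"
      and closed: "\<And>F G. G \<in> X \<Longrightarrow> F \<in> ?S \<Longrightarrow> F - H \<subseteq> G \<Longrightarrow> F \<in> X"
      using X by (auto simp: inv_def)
    \<comment> \<open>By \<open>card3\<close>, \<open>G\<close> has a third vertex \<open>c\<close>
      outside \<open>H\<close>; since \<open>card H = m - 3\<close>, the set
      \<open>{a, b, c} \<union> H\<close> has size \<open>m\<close> and belongs to \<open>X\<close>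
      by \<open>closed\<close>.\<close>
    have edge: "\<exists>F\<in>X. {a, b} \<union> H \<subseteq> F"
      if ab: "a \<in> V" "b \<in> V" "a \<noteq> b" "G \<in> X" "{a, b} \<subseteq> G" for a b G
    proof -
      have "G \<in> ?S" using ab XS by auto
      have "\<not> G - H \<subseteq> {a, b}"
      proof
        assume "G - H \<subseteq> {a, b}"
        then have "card (G - H) \<le> card {a, b}" by (intro card_mono) auto
        also have "\<dots> \<le> 2" by (simp add: card_insert_if)
        finally show False using card3[OF \<open>G \<in> ?S\<close>] by simp
      qed
      then obtain c where c: "c \<in> G" "c \<notin> H" "c \<noteq> a" "c \<noteq> b" by auto
      then have "c \<in> V" using \<open>G \<in> ?S\<close> by auto
      have c1: "card ({a, b, c} \<union> H) = m"
      proof (subst card_Un_disjoint)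
        show "{a, b, c} \<inter> H = {}" using ab c H(3) by auto
        show "card {a, b, c} + card H = m" using ab c H(2) m by auto
      qed (use H(1) in auto)
      have c2: "{a, b, c} \<union> H \<subseteq> V \<union> H" using ab(1,2) \<open>c \<in> V\<close> by blast
      have c3: "{a, b, c} \<union> H - H \<subseteq> G" using ab(5) c(1) by blast
      have "{a, b, c} \<union> H \<in> X"
        using c1 c2 by (intro closed[OF ab(4) _ c3] CollectI conjI)
      then show ?thesis by (rule bexI[rotated]) auto
    qed
    show ?thesis
    proof (cases "\<exists>y\<in>V. \<exists>z\<in>V. \<forall>G\<in>X. \<not> {y, z} \<subseteq> G")
      case True
      then obtain y z where yz: "y \<in> V" "z \<in> V" "\<And>G. G \<in> X \<Longrightarrow> \<not> {y, z} \<subseteq> G" by blast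
      \<comment> \<open>The closed neighbourhood of \<open>y\<close>. It contains \<open>y\<close>
        but not \<open>z\<close>, so connectedness of \<open>X0\<close> yields a facet of
        \<open>X0\<close> with a vertex \<open>w\<close> inside and a vertex \<open>v\<close>
        outside; \<open>{y, v}\<close> is the missing edge to add.\<close>
      define R where "R = {v. \<exists>G\<in>X. {y, v} \<subseteq> G}"
      have "y \<in> R" using yz(1) V(2) XS(1) by (auto simp: R_def)
      moreover have "z \<notin> R" using yz by (auto simp: R_def)
      ultimately have "\<not> (\<Union>X0 \<subseteq> R \<or> \<Union>X0 \<inter> R = {})" using V(2) yz by blast
      moreover have "2 \<le> m" using m by simp
      ultimately have "\<not> (\<forall>F\<in>X0. F \<subseteq> R \<or> F \<inter> R = {})"
        using shed_dec_connected[OF X0 \<open>2 \<le> m\<close>, of R] by metis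
      then obtain F w v where F: "F \<in> X0" "w \<in> F" "w \<in> R" "v \<in> F" "v \<notin> R" by blast
      obtain G where G: "G \<in> X" "{y, w} \<subseteq> G" using F(3) by (auto simp: R_def)
      have wv: "w \<in> V" "v \<in> V" "F \<in> X" using F V(2) XS by auto
      have "w \<noteq> y" using F(2,4,5) \<open>F \<in> X\<close> unfolding R_def by blast
      then have ne: "w \<noteq> y" "v \<noteq> y" "v \<noteq> w" using F(3,5) \<open>y \<in> R\<close> by auto
      have nonface: "\<not> {y, v} \<subseteq> G" if "G \<in> X" for G using F(5) that by (auto simp: R_def)
      let ?N = "{y, v} \<union> insert w H" and ?X = "X \<union> (\<union>) {y, v} ` {insert w H}"
      have wH: "y \<notin> H" "v \<notin> H" "w \<notin> H" using H(3) wv yz by auto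
      have cN: "card ?N = m" using wH ne H m by auto
      \<comment> \<open>Shedding the edge \<open>{y, v}\<close> uses \<open>1 \<le> k\<close>; its
        link is the simplex \<open>insert w H\<close>, and purity comes from \<open>edge\<close> for
        \<open>{v, w}\<close> and \<open>{y, w}\<close>. \<open>J\<close> is \<open>H\<close> for
        the invariant and \<open>{}\<close> for \<open>grow\<close>.\<close>
      have shed: "shed_dec k J m ?X" if "J \<subseteq> H" for J
      proof (rule shed_dec.shed[OF shed_dec_antimono[OF dec that]])
        show "shed_dec k J (m - 2) {insert w H}"
          by (rule shed_dec.single) (use wH ne H m that in auto)
        show "\<exists>F\<in>X. G' \<union> ({y, v} - {u}) \<subseteq> F" if "G' \<in> {insert w H}" "u \<in> {y, v}" for G' u
        proof (cases "u = y")
          case True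
          then show ?thesis using edge[of v w F] wv F ne that by auto
        next
          case False
          then have "u = v" using that by auto
          then show ?thesis using edge[of y w G] wv G ne yz that by auto
        qed
      qed (use nonface wH ne k m that in auto)
      have "?N \<in> ?S" using cN wv yz by auto
      have "inv ?X"
        unfolding inv_def
      proof (intro conjI ballI impI)
        fix G' F' assume G': "G' \<in> ?X" and F': "F' \<in> ?S" "F' - H \<subseteq> G'"
        show "F' \<in> ?X"
        proof (cases "G' \<in> X")
          case False
          then have "F' \<subseteq> ?N" using G' F' by auto
          then have "F' = ?N" using card_subset_eq[of ?N F'] cN F' H(1) by auto
          then show ?thesis by simp
        qed (use closed F' in blast)
      qed (use XS \<open>?N \<in> ?S\<close> shed in auto)
      moreover have "?N \<notin> X" using nonface[of ?N] by auto
      then have "X \<subset> ?X" by auto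
      moreover have "grow k m X ?X"
        using grow_insert[of k m ?N X] shed[of "{}"] by simp
      ultimately show ?thesis by blast
    next
      case False
      \<comment> \<open>All edges are present now; \<open>F0\<close> is a missing set whose part
        outside \<open>H\<close> is smallest.\<close>
      obtain F1 where "F1 \<in> ?S - X" using X(2) XS(2) by blast
      then obtain F0 where F0: "F0 \<in> ?S - X"
        and least: "\<forall>F. F \<in> ?S - X \<longrightarrow> card (F0 - H) \<le> card (F - H)"
        using ex_has_least_nat[of "\<lambda>F. F \<in> ?S - X" F1 "\<lambda>F. card (F - H)"] by blast
      have minimal: "F \<in> X" if "F \<in> ?S" "card (F - H) < card (F0 - H)" for F
        using least that by (meson DiffI not_less)
      define A where "A = F0 - H"
      let ?L = "subsets_of_card H (m - card A)"
      have A: "finite A" "A \<inter> H = {}" "A \<subseteq> V" "3 \<le> card A"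
        using F0 finF[of F0] card3[of F0] by (auto simp: A_def)
      have "card A \<le> card F0" unfolding A_def using finF[of F0] F0 by (intro card_mono) auto
      then have Am: "m = m - card A + card A" using F0 by simp
      have nonface: "\<not> A \<subseteq> F" if "F \<in> X" for F
        using closed[OF that, of F0] F0 by (auto simp: A_def)
      have finL: "finite B" if "B \<in> ?L" for B using that H(1) finite_subset by auto
      have nb: "\<exists>F\<in>X. A - {x} \<union> B \<subseteq> F" if B: "B \<in> ?L" and x: "x \<in> A" for B x
      proof (cases "card A = 3")
        \<comment> \<open>Here \<open>m - card A = card H\<close> forces \<open>B = H\<close>, and
          \<open>A - {x}\<close> is an edge, hence present.\<close>
        case True
        then have "B = H" using B card_subset_eq[OF H(1), of B] H(2) by auto
        have "card (A - {x}) = 2" using True x A(1) by simp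
        then obtain a b where ab: "A - {x} = {a, b}" "a \<noteq> b" by (auto simp: card_2_iff)
        then have "a \<in> V" "b \<in> V" using A(3) by auto
        then obtain G where "G \<in> X" "{a, b} \<subseteq> G" using False by blast
        then show ?thesis using edge[of a b G] ab \<open>B = H\<close> \<open>a \<in> V\<close> \<open>b \<in> V\<close> by simp
      next
        \<comment> \<open>Now \<open>B\<close> misses some \<open>h\<close>. Adding it restores size
          \<open>m\<close> while the part outside \<open>H\<close> is only \<open>A - {x}\<close>,
          so the minimality of \<open>F0\<close> applies.\<close>
        case card: False
        then have "card B < card H" using B H(2) A(4) Am by auto
        then obtain h where h: "h \<in> H" "h \<notin> B" using B by (metis (lifting) mem_Collect_eq nless_le subset_antisym subsetI)
        let ?F = "insert h (A - {x} \<union> B)"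
        have "card (A - {x} \<union> B) = card A - 1 + card B"
          using A B finL[OF B] x by (subst card_Un_disjoint) auto
        moreover have "h \<notin> A - {x} \<union> B" using h A by auto
        ultimately have "card ?F = m" using A(1,4) finL[OF B] B Am by simp
        then have "?F \<in> ?S" using A(3) B h by auto
        moreover have "?F - H = A - {x}" using A B h by auto
        then have "card (?F - H) < card (F0 - H)"
          using card_Diff1_less[OF A(1) x] A_def by metis
        ultimately have "?F \<in> X" using minimal by blast
        then show ?thesis by blast
      qed
      \<comment> \<open>Taking \<open>J = H\<close> with all of \<open>?L\<close> preserves the
        invariant; \<open>J = {}\<close> with partial families \<open>L\<close> orders the
        insertions.\<close>
      have attach: "shed_dec k J m (X \<union> (\<union>) A ` L)"
        if "J \<subseteq> H" "L \<subseteq> ?L" "shed_dec k J (m - card A) L" for J L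
      proof (rule shed_dec_attach[OF dec that(3,1) _ A(1,2) Am])
        show "L \<subseteq> Pow H" using that(2) by blast
        show "\<not> A \<subseteq> F" if "F \<in> X" for F using nonface that .
        show "\<exists>F\<in>X. A - {x} \<union> B \<subseteq> F" if "B \<in> L" "x \<in> A" for B x
          using nb[of B x] that \<open>L \<subseteq> ?L\<close> by blast
      qed
      let ?X = "X \<union> (\<union>) A ` ?L"
      have L: "shed_dec k H (m - card A) ?L"
        by (rule shed_dec.full) (use H A in auto)
      have S: "A \<union> B \<in> ?S" if "B \<in> ?L" for B
      proof -
        have "card (A \<union> B) = m"
          using shed_dec_uniform(3)[OF attach[OF order.refl order.refl L], of "A \<union> B"] that by blast
        then show ?thesis using that A(3) by blast
      qed
      have "inv ?X"
        unfolding inv_def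
      proof (intro conjI ballI impI)
        fix G' F' assume G': "G' \<in> ?X" and F': "F' \<in> ?S" "F' - H \<subseteq> G'"
        show "F' \<in> ?X"
        proof (cases "G' \<in> X")
          case False
          then obtain B where B: "B \<in> ?L" "G' = A \<union> B" using G' by auto
          then have sub: "F' - H \<subseteq> A" using F' by auto
          \<comment> \<open>If \<open>F' - H\<close> is all of \<open>A\<close>, then
            \<open>F'\<close> is one of the added facets; otherwise it lies in some
            \<open>A - {x}\<close>, which \<open>nb\<close> places under a facet in
            \<open>X\<close>.\<close>
          show ?thesis
          proof (cases "F' - H = A")
            case True
            then have "F' = A \<union> (F' \<inter> H)" by auto
            moreover have "card (F' \<inter> H) = m - card A"
              using card_Diff_subset_Int[of F' H] finF[OF F'(1)] F'(1) True
                card_mono[of F' "F' \<inter> H"] by auto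
            ultimately show ?thesis by blast
          next
            case False
            then obtain x where "x \<in> A" "F' - H \<subseteq> A - {x}" using sub by blast
            then show ?thesis using nb[OF B(1), of x] closed F'(1) by (meson UnI1 le_supE order_trans)
          qed
        qed (use closed F' in blast)
      next
        show "?X \<subseteq> ?S" using XS(2) S by blast
      qed (use XS(1) attach[OF order.refl order.refl L] in auto)
      moreover have "F0 \<in> ?X"
      proof -
        have "F0 = A \<union> (F0 \<inter> H)" by (auto simp: A_def)
        moreover have "card (F0 \<inter> H) = m - card A"
          using card_Diff_subset_Int[of F0 H] finF[of F0] F0
            card_mono[of F0 "F0 \<inter> H"] by (auto simp: A_def)
        ultimately show ?thesis by blast
      qed
      then have "X \<subset> ?X" using F0 by blast
      moreover have "grow k m X ?X"
      proof -
        have "grow k m (X \<union> (\<union>) A ` {}) ?X"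
        by (rule grow_attach[OF grow_empty[OF shed_dec_antimono[OF L]]]) (use attach in auto)
        then show ?thesis by simp
      qed
      ultimately show ?thesis by blast
    qed
  qed
  have "grow k m X ?S" if "inv X" for X
    using that
  proof (induction "card (?S - X)" arbitrary: X rule: less_induct)
    case less
    show ?case
    proof (cases "X = ?S")
      case False
      then obtain X' where X': "inv X'" "X \<subset> X'" "grow k m X X'" using step less.prems by blast
      then have "?S - X' \<subset> ?S - X" by (auto simp: inv_def)
      then have "card (?S - X') < card (?S - X)" using fin by (intro psubset_card_mono) auto
      then show ?thesis using less.hyps X' grow_trans by blast
    qed simp
  qed
  moreover have "inv (skel_join H m X0)"
    unfolding inv_def
  proof (intro conjI ballI impI)
    show "X0 \<subseteq> skel_join H m X0"
      using grow_subset[OF grow_skel_join[OF H(1), of k "m - 1" X0]] X0 V(2) H(3) m by simp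
    show "skel_join H m X0 \<subseteq> ?S" using V(2) by (auto simp: skel_join_def)
    show "shed_dec k H m (skel_join H m X0)"
      by (rule shed_dec_skel_join[OF X0 order.refl H(1)]) (use V(2) H(3) in simp)
    show "F \<in> skel_join H m X0" if "G \<in> skel_join H m X0" "F \<in> ?S" "F - H \<subseteq> G" for F G
    proof -
      have "\<exists>G'\<in>X0. G - H \<subseteq> G'" using that(1) by (simp add: skel_join_def)
      then have "\<exists>G'\<in>X0. F - H \<subseteq> G'" using that(3) by blast
      then show ?thesis using that(2) finF[OF that(2)] by (simp add: skel_join_def)
    qed
  qed
  moreover have "grow k m X0 (skel_join H m X0)"
    using grow_skel_join[OF H(1), of k "m - 1" X0] X0 V(2) H(3) m by simp
  ultimately show ?thesis using grow_trans by blast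
qed

section \<open>Translation between facet families and simplicial complexes\<close>

lemma facets_generated_complex:
  assumes "\<And>F. F \<in> X \<Longrightarrow> finite F \<and> card F = m"
  shows "facets (generated_complex X) = X"
proof
  show "facets (generated_complex X) \<subseteq> X"
  proof
    fix F assume F: "F \<in> facets (generated_complex X)"
    then obtain G where G: "G \<in> X" "F \<subseteq> G" by (auto simp: facets_def generated_complex_def)
    then have "G \<in> generated_complex X" by (auto simp: generated_complex_def)
    then show "F \<in> X" using F G by (auto simp: facets_def)
  qed
  show "X \<subseteq> facets (generated_complex X)"
  proof
    fix F assume F: "F \<in> X"
    have "G = F" if G: "G \<in> generated_complex X" "F \<subseteq> G" for G
    proof -
      obtain F' where F': "F' \<in> X" "G \<subseteq> F'" using G(1) by (auto simp: generated_complex_def)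
      then have "F = F'" using assms F G(2) card_subset_eq[of F' F] by (metis order_trans)
      then show ?thesis using F' G(2) by blast
    qed
    then show "F \<in> facets (generated_complex X)"
      using F by (auto simp: facets_def generated_complex_def)
  qed
qed

lemma simplicial_complex_generated_complex:
  assumes "finite X" "\<And>F. F \<in> X \<Longrightarrow> finite F"
  shows "simplicial_complex (generated_complex X)"
  unfolding simplicial_complex_def
proof
  show "\<exists>V. finite V \<and> generated_complex X \<subseteq> Pow V"
    using assms by (intro exI[of _ "\<Union>X"]) (auto simp: generated_complex_def)
  show "\<forall>F\<in>generated_complex X. \<forall>G. G \<subseteq> F \<longrightarrow> G \<in> generated_complex X"
    unfolding generated_complex_def by blast
qed

lemma complex_dim_uniform:
  assumes "facets C \<noteq> {}" "\<And>F. F \<in> facets C \<Longrightarrow> card F = m"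
  shows "complex_dim C = int m - 1"
proof -
  have "face_dim ` facets C = {int m - 1}" using assms by (auto simp: face_dim_def)
  then show ?thesis by (simp add: complex_dim_def)
qed

lemma card_facet:
  assumes "pure_complex C" "F \<in> facets C"
  shows "int (card F) = complex_dim C + 1"
  using complex_dim_uniform[of C "card F"] assms unfolding pure_complex_def by fastforce

lemma face_subset_facet:
  assumes "simplicial_complex C" "G \<in> C"
  shows "\<exists>F\<in>facets C. G \<subseteq> F"
proof -
  have "finite C" using assms(1) finite_subset by (auto simp: simplicial_complex_def)
  then obtain F where "F \<in> C" "G \<subseteq> F" "\<forall>F'\<in>C. F \<subseteq> F' \<longrightarrow> F = F'"
    using finite_has_maximal2[of C G] assms(2) by auto
  then show ?thesis by (auto simp: facets_def)
qed

lemma finite_face: "simplicial_complex C \<Longrightarrow> F \<in> C \<Longrightarrow> finite F"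
  by (meson PowD finite_subset simplicial_complex_def subsetD)

lemma simplicial_complex_mono:
  assumes "simplicial_complex C" "D \<subseteq> C" "\<And>F G. F \<in> D \<Longrightarrow> G \<subseteq> F \<Longrightarrow> G \<in> D"
  shows "simplicial_complex D"
  using assms unfolding simplicial_complex_def by (meson order_trans)

text \<open>The last premise of \<open>shed\<close> puts every face that omits a vertex of
  \<open>e\<close> under a facet in \<open>Y\<close>, so \<open>Y\<close> and \<open>L\<close>
  generate exactly the deletion and the link.\<close>

lemma decomposable_generated_complex:
  assumes "shed_dec k {} m X"
  shows "decomposable k (generated_complex X)"
proof -
  have base: "decomposable k (generated_complex {F})" if "finite F" for F :: "'a set"
  proof -
    have fc: "facets (generated_complex {F}) = {F}"
      using that by (intro facets_generated_complex[of _ "card F"]) auto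
    show ?thesis
    proof (rule decomposable.simplex)
      show "simplicial_complex (generated_complex {F})"
        using that by (intro simplicial_complex_generated_complex) auto
    qed (auto simp: fc pure_complex_def is_simplex_def)
  qed
  show ?thesis using assms
  proof (induction rule: shed_dec.induct)
    case (single F m)
    then show ?case using base by simp
  next
    case (full m)
    then have eq: "subsets_of_card {} m = {{}}" by auto
    show ?case unfolding eq using base by simp
  next
    case (shed m Y l L e)
    let ?X = "Y \<union> (\<union>) e ` L"
    have dec: "shed_dec k {} m ?X" by (rule shed_dec.shed[OF shed.hyps])
    note uX = shed_dec_uniform[OF dec] and uY = shed_dec_uniform[OF shed.hyps(1)]
    have fX: "facets (generated_complex ?X) = ?X" by (rule facets_generated_complex[OF uX(3)])
    have fY: "facets (generated_complex Y) = Y" by (rule facets_generated_complex[OF uY(3)])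
    obtain G0 where G0: "G0 \<in> L" using shed_dec_uniform(2)[OF shed.hyps(2)] by auto
    have del: "deletion e (generated_complex ?X) = generated_complex Y"
    proof
      show "generated_complex Y \<subseteq> deletion e (generated_complex ?X)"
        using shed.hyps(8) by (auto simp: deletion_def generated_complex_def)
      show "deletion e (generated_complex ?X) \<subseteq> generated_complex Y"
      proof
        fix G assume "G \<in> deletion e (generated_complex ?X)"
        then obtain F where F: "F \<in> ?X" "G \<subseteq> F" "\<not> e \<subseteq> G"
          unfolding deletion_def generated_complex_def by blast
        show "G \<in> generated_complex Y"
        proof (cases "F \<in> Y")
          case True
          then show ?thesis using F by (auto simp: generated_complex_def)
        next
          case False
          then obtain G' where G': "G' \<in> L" "F = e \<union> G'" using F by auto
          obtain u where u: "u \<in> e" "u \<notin> G" using F(3) by auto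
          have "G \<subseteq> G' \<union> (e - {u})" using F(2) G' u by auto
          then show ?thesis
            using shed.hyps(10)[OF G'(1) u(1)] unfolding generated_complex_def by blast
        qed
      qed
    qed
    have lk: "link e (generated_complex ?X) = generated_complex L"
    proof
      show "generated_complex L \<subseteq> link e (generated_complex ?X)"
      proof
        fix G assume "G \<in> generated_complex L"
        then obtain G' where G': "G' \<in> L" "G \<subseteq> G'" by (auto simp: generated_complex_def)
        then have "G \<union> e \<subseteq> e \<union> G'" "G \<subseteq> e \<union> G'" "e \<union> G' \<in> ?X" "G \<inter> e = {}"
          using shed.hyps(9) by auto
        then show "G \<in> link e (generated_complex ?X)"
          unfolding link_def generated_complex_def by blast
      qed
      show "link e (generated_complex ?X) \<subseteq> generated_complex L"
      proof
        fix G assume "G \<in> link e (generated_complex ?X)"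
        then obtain F where F: "F \<in> ?X" "G \<union> e \<subseteq> F" "G \<inter> e = {}"
          unfolding link_def generated_complex_def by blast
        then have "F \<notin> Y" using shed.hyps(8) by auto
        then obtain G' where "G' \<in> L" "F = e \<union> G'" using F by auto
        moreover then have "G \<subseteq> G'" using F by auto
        ultimately show "G \<in> generated_complex L" by (auto simp: generated_complex_def)
      qed
    qed
    show ?case
    proof (rule decomposable.shed)
      show "simplicial_complex (generated_complex ?X)"
        by (rule simplicial_complex_generated_complex) (use uX in auto)
      show "pure_complex (generated_complex ?X)"
        unfolding pure_complex_def fX using uX(3) by simp
      show "shedding_face (generated_complex ?X) e"
        unfolding shedding_face_def del
      proof (intro conjI)
        show "e \<in> generated_complex ?X" using G0 by (auto simp: generated_complex_def)
        show "pure_complex (generated_complex Y)"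
          unfolding pure_complex_def fY using uY(3) by simp
        have "complex_dim (generated_complex Y) = int m - 1"
          by (rule complex_dim_uniform) (use fY uY in auto)
        moreover have "complex_dim (generated_complex ?X) = int m - 1"
          using complex_dim_uniform[of "generated_complex ?X" m] uX(2,3) unfolding fX by blast
        ultimately show "complex_dim (generated_complex Y) = complex_dim (generated_complex ?X)"
          by simp
      qed (use shed.hyps in auto)
      show "face_dim e \<le> int k" using shed.hyps(5) by (simp add: face_dim_def)
      show "decomposable k (deletion e (generated_complex ?X))" unfolding del by (rule shed.IH)
      show "decomposable k (link e (generated_complex ?X))" unfolding lk by (rule shed.IH)
    qed
  qed
qed

text \<open>Purity of the deletion in the same dimension makes its facets exactly the facets of
  \<open>C\<close> not containing \<open>e\<close>. Every face of the deletion lies under one of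
  them, which gives the last premise of \<open>shed\<close>.\<close>

lemma shed_dec_facets:
  assumes "decomposable k C" "\<And>F. F \<in> facets C \<Longrightarrow> card F = m"
  shows "shed_dec k {} m (facets C)"
  using assms
proof (induction arbitrary: m rule: decomposable.induct)
  case (simplex C)
  obtain F where F: "F \<in> facets C" "\<And>G. G \<in> facets C \<Longrightarrow> G = F"
    using simplex(3) unfolding is_simplex_def by blast
  then have eq: "facets C = {F}" by blast
  have "finite F" using F(1) finite_face[OF simplex(1)] by (simp add: facets_def)
  then show ?case unfolding eq by (rule shed_dec.single[OF _ _ simplex(4)[OF F(1)]]) simp
next
  case (shed C e)
  let ?D = "deletion e C" and ?L = "link e C"
  have e: "e \<in> C" "e \<noteq> {}" using shed.hyps(3) by (auto simp: shedding_face_def)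
  have closed: "G \<in> C" if "F \<in> C" "G \<subseteq> F" for F G
    using shed.hyps(1) that by (auto simp: simplicial_complex_def)
  note fin = finite_face[OF shed.hyps(1)]
  have scD: "simplicial_complex ?D"
    by (rule simplicial_complex_mono[OF shed.hyps(1)]) (use closed in \<open>auto simp: deletion_def\<close>)
  have "{} \<in> ?D" using closed[OF e(1)] e(2) by (auto simp: deletion_def)
  have dimC: "complex_dim C = int m - 1"
    by (rule complex_dim_uniform) (use face_subset_facet[OF shed.hyps(1) e(1)] shed.prems in auto)
  have cD: "card F = m" if "F \<in> facets ?D" for F
    using card_facet[of ?D F] that shed.hyps(3) dimC by (auto simp: shedding_face_def)
  have facetC: "F \<in> facets C" if F: "F \<in> C" "card F = m" for F
  proof -
    obtain F' where F': "F' \<in> facets C" "F \<subseteq> F'" using face_subset_facet[OF shed.hyps(1) F(1)] by blast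
    then have "finite F'" "card F' = m" using fin shed.prems by (auto simp: facets_def)
    then show ?thesis using F' F(2) card_subset_eq by metis
  qed
  have DC: "facets ?D \<subseteq> facets C" using facetC cD by (auto simp: facets_def deletion_def)
  \<comment> \<open>The maps \<open>G \<mapsto> e \<union> G\<close> and, below,
    \<open>F \<mapsto> F - e\<close> match the facets of the link with the facets of
    \<open>C\<close> containing \<open>e\<close>.\<close>
  have link_facet: "e \<union> G \<in> facets C" "G \<inter> e = {}" if "G \<in> facets ?L" for G
  proof -
    have G: "G \<in> ?L" "\<And>G'. G' \<in> ?L \<Longrightarrow> G \<subseteq> G' \<Longrightarrow> G' = G"
      using that by (auto simp: facets_def)
    show "G \<inter> e = {}" using G(1) by (auto simp: link_def)
    have "F = e \<union> G" if F: "F \<in> C" "e \<union> G \<subseteq> F" for F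
    proof -
      have "F - e \<in> ?L" using F closed[OF F(1)] by (auto simp: link_def Un_absorb2)
      moreover have "G \<subseteq> F - e" using F \<open>G \<inter> e = {}\<close> by auto
      ultimately have "F - e = G" using G(2) by blast
      then show ?thesis using F by auto
    qed
    moreover have "e \<union> G \<in> C" using G(1) by (auto simp: link_def Un_commute)
    ultimately show "e \<union> G \<in> facets C" unfolding facets_def by blast
  qed
  have facet_link: "F - e \<in> facets ?L" if F: "F \<in> facets C" "e \<subseteq> F" for F
  proof -
    have "F \<in> C" and max: "\<And>G. G \<in> C \<Longrightarrow> F \<subseteq> G \<Longrightarrow> G = F" using F by (auto simp: facets_def)
    then have "F - e \<in> ?L" using F(2) closed[of F "F - e"] by (auto simp: link_def Un_absorb2)
    moreover have "G = F - e" if G: "G \<in> ?L" "F - e \<subseteq> G" for G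
    proof -
      have "G \<union> e = F" using max[of "G \<union> e"] G by (auto simp: link_def)
      then show ?thesis using G by (auto simp: link_def)
    qed
    ultimately show ?thesis unfolding facets_def by blast
  qed
  have cL: "card G + card e = m" if "G \<in> facets ?L" for G
  proof -
    have "e \<union> G \<in> facets C" "G \<inter> e = {}" using link_facet that by auto
    moreover have "finite (e \<union> G)" using fin[of "e \<union> G"] calculation(1) by (auto simp: facets_def)
    moreover have "card (e \<union> G) = m" using shed.prems calculation(1) .
    ultimately show ?thesis by (subst (asm) card_Un_disjoint) auto
  qed
  obtain F0 where F0: "F0 \<in> facets C" "e \<subseteq> F0" using face_subset_facet[OF shed.hyps(1) e(1)] by auto
  \<comment> \<open>The facet \<open>F0\<close> through \<open>e\<close> shows
    \<open>card e \<le> m\<close>, so the truncated difference is exact.\<close>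
  have m: "m = (m - card e) + card e" using cL[OF facet_link[OF F0]] by simp
  have "facets C = facets ?D \<union> (\<union>) e ` facets ?L" (is "_ = ?r")
  proof
    show "?r \<subseteq> facets C" using DC link_facet by auto
    show "facets C \<subseteq> ?r"
    proof
      fix F assume F: "F \<in> facets C"
      show "F \<in> ?r"
      proof (cases "e \<subseteq> F")
        case True
        then have "F = e \<union> (F - e)" by auto
        then show ?thesis using facet_link[OF F True] by blast
      next
        case False
        then show ?thesis using F by (auto simp: facets_def deletion_def)
      qed
    qed
  qed
  moreover have "shed_dec k {} m \<dots>"
  proof (rule shed_dec.shed[OF _ _ _ e(2) _ _ m])
    show "shed_dec k {} m (facets ?D)" by (rule shed.IH(1)) (rule cD)
    show "shed_dec k {} (m - card e) (facets ?L)" by (rule shed.IH(2)) (use cL in fastforce)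
    show "finite e" using fin e by simp
    show "card e \<le> k + 1" using shed.hyps(4) by (simp add: face_dim_def)
    show "\<not> e \<subseteq> F" if "F \<in> facets ?D" for F using that by (auto simp: facets_def deletion_def)
    show "G \<inter> e = {}" if "G \<in> facets ?L" for G using link_facet(2) that .
    show "\<exists>F\<in>facets ?D. G \<union> (e - {u}) \<subseteq> F" if "G \<in> facets ?L" "u \<in> e" for G u
    proof (rule face_subset_facet[OF scD])
      have "e \<union> G \<in> C" using link_facet(1)[OF that(1)] by (auto simp: facets_def)
      then have "G \<union> (e - {u}) \<in> C" by (rule closed) auto
      moreover have "u \<notin> G \<union> (e - {u})" using link_facet(2)[OF that(1)] that(2) by auto
      ultimately show "G \<union> (e - {u}) \<in> ?D" using that(2) by (auto simp: deletion_def)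
    qed
  qed simp
  ultimately show ?case by simp
qed

section \<open>The ordered list of missing facets\<close>

lemma grow_list:
  assumes "grow k m X Y"
  shows "\<exists>Fs. distinct Fs \<and> set Fs = Y - X \<and>
    (\<forall>i\<in>{1..length Fs}. shed_dec k {} m (X \<union> set (take i Fs)))"
  using assms
proof (induction rule: grow_induct)
  case refl
  then show ?case by (intro exI[of _ "[]"]) simp
next
  case (insert Y F)
  then obtain Fs where Fs: "distinct Fs" "set Fs = Y - X"
    "\<And>i. i \<in> {1..length Fs} \<Longrightarrow> shed_dec k {} m (X \<union> set (take i Fs))" by blast
  have XY: "X \<subseteq> Y" using insert.hyps(1) by (rule grow_subset)
  have "shed_dec k {} m (X \<union> set (take i (Fs @ [F])))" if "i \<in> {1..length (Fs @ [F])}" for i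
  proof (cases "i = Suc (length Fs)")
    case True
    have "X \<union> set (take i (Fs @ [F])) = insert F Y" using True Fs(2) XY by auto
    then show ?thesis using insert.hyps(3) by simp
  qed (use that Fs(3)[of i] in auto)
  moreover have "distinct (Fs @ [F])" "set (Fs @ [F]) = insert F Y - X"
    using Fs insert.hyps(2) XY by auto
  ultimately show ?case by blast
qed

theorem theorem4p10:
  fixes d n :: nat and C :: "nat set set" and H :: "nat set"
  assumes "d \<ge> 2"
    and "simplicial_complex C"
    and "pure_complex C"
    and "complex_dim C = int d"
    and "decomposable 1 C"
    and "vertices C = {1..n}"
    and "finite H"
    and "card H = d - 2"
    and "H \<inter> {1..n} = {}"
  shows "\<exists>Fs :: nat set list.
           distinct Fs \<and>
           set Fs = facets (skeleton d (Pow ({1..n} \<union> H))) - facets C \<and>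
           (\<forall>i\<in>{1..length Fs}. decomposable 1 (add_facets C (set (take i Fs))))"
proof -
  let ?W = "{1..n} \<union> H"
  have card: "card F = d + 1" if "F \<in> facets C" for F
    using card_facet[OF assms(3) that] assms(4) by simp
  have dec: "shed_dec 1 {} (d + 1) (facets C)"
    using assms(5) card by (rule shed_dec_facets)
  have V: "\<Union>(facets C) = {1..n}"
  proof -
    have "v \<in> \<Union>(facets C) \<longleftrightarrow> v \<in> vertices C" for v
    proof
      assume "v \<in> \<Union>(facets C)"
      then obtain F where "F \<in> C" "{v} \<subseteq> F" by (auto simp: facets_def)
      then show "v \<in> vertices C"
        using assms(2) unfolding simplicial_complex_def vertices_def by blast
    next
      assume "v \<in> vertices C"
      then show "v \<in> \<Union>(facets C)"
        using face_subset_facet[OF assms(2), of "{v}"] by (auto simp: vertices_def)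
    qed
    then show ?thesis using assms(6) by blast
  qed
  obtain F where F: "F \<in> facets C" using shed_dec_uniform(2)[OF dec] by auto
  then have "d + 1 \<le> card ?W"
    using card_mono[of ?W F] card[OF F] V assms(7) by auto
  then have sk: "facets (skeleton d (Pow ?W)) = subsets_of_card ?W (d + 1)"
    using assms(7) by (intro facets_skeleton_Pow) auto
  \<comment> \<open>With \<open>m = d + 1\<close>, the size \<open>d - 2\<close> of \<open>H\<close>
    is \<open>m - 3\<close>, and \<open>d \<ge> 2\<close> gives \<open>3 \<le> m\<close>.\<close>
  have "grow 1 (d + 1) (facets C) (subsets_of_card ?W (d + 1))"
    by (rule grow_complete[OF dec _ _ _ V]) (use assms(1,7-9) in auto)
  then obtain Fs where Fs: "distinct Fs" "set Fs = subsets_of_card ?W (d + 1) - facets C"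
    "\<forall>i\<in>{1..length Fs}. shed_dec 1 {} (d + 1) (facets C \<union> set (take i Fs))"
    using grow_list by blast
  have "decomposable 1 (add_facets C (set (take i Fs)))" if "i \<in> {1..length Fs}" for i
    unfolding add_facets_def using Fs(3) that by (metis decomposable_generated_complex)
  then show ?thesis using Fs(1,2) unfolding sk by (intro exI[of _ Fs] conjI ballI)
qed

end
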